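(* Let $X_1,X_2,\ldots$ be iid random variables with cdf $F$, let $F_n$ be the empirical cdf of $X_1,\dots,X_n$, and let $p\in(0,1)$. Let $$\mathrm{TV@R}(p)=\frac{1}{p}\int_0^p F^{-1}(u)\,du,\qquad \mathrm{TV@R}_n(p)=\frac{1}{p}\int_0^p F_n^{-1}(u)\,du .$$ (1) If $F\in\mathcal{F}^{-}_{1}$, then $\mathrm{TV@R}_n(p)\stackrel{\mathbb{P}}{\to}\mathrm{TV@R}(p)$ as $n\to\infty$. (2) If $F\in\mathcal{F}^{-}_{2}$ and the quantile function $F^{-1}$ is continuous at the point $p$, then $$\sqrt{n}\,\big(\mathrm{TV@R}_n(p)-\mathrm{TV@R}(p)\big)\stackrel{d}{\to}\mathcal{N}(0,\sigma^2(p)),$$ where $$\sigma^2(p)=\frac{1}{p^2}\int_{-\infty }^{F^{-1}(p)} \int_{-\infty }^{F^{-1}(p)} \big( F(x \wedge y) -F(x)F(y) \big)\, dx\, dy .$$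
   Context: The quantile function of a cdf $F$ is $F^{-1}(u)=\inf\{x\in\mathbb{R}: F(x)\ge u\}$ for $u\in(0,1]$ and $F^{-1}(0)=\lim_{u\downarrow 0}F^{-1}(u)$. The empirical cdf is $F_n(x)=\frac1n\sum_{i=1}^n\mathbf{1}\{X_i\le x\}$, with quantile function $F_n^{-1}$ defined in the same way. For $k\in\{1,2\}$, $\mathcal{F}^{-}_{k}$ is the class of cdf's $F$ with $\mathbb{E}((X^{-})^k)<\infty$ for $X\sim F$, where $X^{-}=(-X)\vee 0$ (equivalently, $\int_0^p (F^{-1}(u))^k\,du$ is finite). $x\wedge y=\min\{x,y\}$; $\stackrel{\mathbb{P}}{\to}$ and $\stackrel{d}{\to}$ denote convergence in probability and in distribution; $\mathcal{N}(0,\sigma^2)$ is the normal distribution (degenerate at $0$ if $\sigma^2=0$). *)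

theory Defs
  imports "HOL-Probability.Probability"
begin

text \<open>
  The quantile function takes values in the extended reals: \<open>Inf {} = \<infinity>\<close> can occur at \<open>u = 1\<close>,
  and the limit at \<open>u = 0\<close> can be \<open>-\<infinity>\<close>. For a cdf it is finite on \<open>{0<..<1}\<close>. Only arguments
  in \<open>{0..1}\<close> are meaningful.
\<close>

definition quantile :: "(real \<Rightarrow> real) \<Rightarrow> real \<Rightarrow> ereal" where
  "quantile F u =
     (let Q = (\<lambda>v. Inf (ereal ` {x. F x \<ge> v}))
      in if u = 0 then Lim (at_right 0) Q else Q u)"

text \<open>
  Samples are indexed from \<open>0\<close>, so the first \<open>n\<close> observations are \<open>X 0, \<dots>, X (n - 1)\<close>.
\<close>

definition empirical_cdf :: "(nat \<Rightarrow> 'a \<Rightarrow> real) \<Rightarrow> nat \<Rightarrow> 'a \<Rightarrow> real \<Rightarrow> real" where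
  "empirical_cdf X n \<omega> x = (1 / real n) * (\<Sum>i<n. indicator {..x} (X i \<omega>))"

text \<open>
  The conversion to \<open>real\<close> matters at most at the null set \<open>{0}\<close>, where the quantile may be
  infinite, as long as \<open>F\<close> is a cdf and \<open>0 < p < 1\<close>.
\<close>

definition tvar :: "(real \<Rightarrow> real) \<Rightarrow> real \<Rightarrow> real" where
  "tvar F p = (1 / p) * (LBINT u:{0..p}. real_of_ereal (quantile F u))"

definition neg_moment_class :: "nat \<Rightarrow> (real \<Rightarrow> real) set" where
  "neg_moment_class k =
     {cdf \<mu> | \<mu>. real_distribution \<mu> \<and> integrable \<mu> (\<lambda>x. (max (- x) 0) ^ k)}"

definition tvar_variance :: "(real \<Rightarrow> real) \<Rightarrow> real \<Rightarrow> real" where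
  "tvar_variance F p =
     (let q = real_of_ereal (quantile F p)
      in (1 / p\<^sup>2) * (LBINT y:{..q}. (LBINT x:{..q}. F (min x y) - F x * F y)))"

text \<open>The second parameter is the variance, whereas \<open>normal_density\<close> takes the standard deviation.\<close>

definition normal_distribution :: "real \<Rightarrow> real \<Rightarrow> real measure" where
  "normal_distribution m v =
     (if v = 0 then return borel m else density lborel (normal_density m (sqrt v)))"

text \<open>
  Both modes of convergence include measurability of the sequence, since \<open>measure\<close> and \<open>distr\<close>
  return junk values on non-measurable arguments.
\<close>

definition converges_in_probability ::
    "'a measure \<Rightarrow> (nat \<Rightarrow> 'a \<Rightarrow> real) \<Rightarrow> real \<Rightarrow> bool" where
  "converges_in_probability M Y c \<longleftrightarrow>
     (\<forall>n. Y n \<in> borel_measurable M) \<and>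
     (\<forall>\<epsilon>>0. (\<lambda>n. measure M {\<omega> \<in> space M. \<bar>Y n \<omega> - c\<bar> > \<epsilon>}) \<longlonglongrightarrow> 0)"

definition converges_in_distribution ::
    "'a measure \<Rightarrow> (nat \<Rightarrow> 'a \<Rightarrow> real) \<Rightarrow> real measure \<Rightarrow> bool" where
  "converges_in_distribution M Y \<mu> \<longleftrightarrow>
     (\<forall>n. Y n \<in> borel_measurable M) \<and> weak_conv_m (\<lambda>n. distr M borel (Y n)) \<mu>"

end

theory Submission
  imports Defs
begin

text \<open>
  Write \<open>q\<close> for the \<open>p\<close>-quantile. The idea is the Rockafellar--Uryasev formula: \<open>p \<cdot> TVaR(p)\<close> is the
  maximum over \<open>x\<close> of the concave function \<open>p x - E (x - X)\<^sup>+\<close>, attained at \<open>x = q\<close>. Applied to the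
  empirical measure, evaluation at the fixed point \<open>q\<close> gives a lower bound for the empirical TVaR that
  is an average of iid variables. The error of this bound is at most \<open>|q\<^sub>n - q| |p - avg z|\<close>, where
  \<open>q\<^sub>n\<close> is the empirical quantile and \<open>p - avg z\<close>, with \<open>E z(X) = p\<close>, is a supergradient at \<open>q\<close> of
  the empirical objective. Since \<open>q\<^sub>n\<close> is tight and \<open>p - avg z\<close> is of order \<open>1 / sqrt n\<close>, the error
  vanishes, and it is \<open>o(1 / sqrt n)\<close> when the quantile function is continuous at \<open>p\<close>. The
  law of large numbers and the central limit theorem for \<open>(q - X)\<^sup>+\<close> then give both claims; the variance is
  rewritten through \<open>(q - X)\<^sup>+ = \<integral> 1{X \<le> x \<le> q} dx\<close> and Fubini.
\<close>

section \<open>Limit theorems\<close>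

text \<open>Slutsky's theorem; going through characteristic functions avoids a separate portmanteau argument.\<close>

lemma (in prob_space) converges_in_distribution_add_vanishing:
  fixes Y R :: "nat \<Rightarrow> 'a \<Rightarrow> real"
  assumes Y[measurable]: "\<And>n. Y n \<in> borel_measurable M"
    and R: "converges_in_probability M R 0"
    and \<nu>: "real_distribution \<nu>"
    and char: "\<And>t. (\<lambda>n. char (distr M borel (Y n)) t) \<longlonglongrightarrow> char \<nu> t"
  shows "converges_in_distribution M (\<lambda>n \<omega>. Y n \<omega> + R n \<omega>) \<nu>"
proof -
  have [measurable]: "R n \<in> borel_measurable M" for n
    using R by (simp add: converges_in_probability_def)
  have bound: "norm (char (distr M borel (\<lambda>\<omega>. Y n \<omega> + R n \<omega>)) t - char (distr M borel (Y n)) t)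
      \<le> \<bar>t\<bar> * \<epsilon> + 2 * prob {\<omega>\<in>space M. \<bar>R n \<omega> - 0\<bar> > \<epsilon>}" if "\<epsilon> > 0" for n t \<epsilon>
  proof -
    define A where "A = {\<omega>\<in>space M. \<bar>R n \<omega> - 0\<bar> > \<epsilon>}"
    have A: "A \<in> sets M" unfolding A_def by measurable
    have iA: "integrable M (indicator A :: 'a \<Rightarrow> real)"
      by (rule integrable_real_indicator[OF A]) (simp add: emeasure_eq_measure)
    \<comment> \<open>The factor \<open>iexp (t * Y n \<omega>)\<close> has modulus 1, so only
      \<open>iexp (t * R n \<omega>) - 1\<close> matters. Its norm is at most 2 everywhere and at
      most \<open>\<bar>t\<bar> * \<epsilon>\<close> off \<open>A\<close>.\<close>
    have pt: "norm (iexp (t * (Y n \<omega> + R n \<omega>)) - iexp (t * Y n \<omega>)) \<le> \<bar>t\<bar> * \<epsilon> + 2 * indicator A \<omega>"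
      if "\<omega> \<in> space M" for \<omega>
    proof -
      have "iexp (t * (Y n \<omega> + R n \<omega>)) - iexp (t * Y n \<omega>) = iexp (t * Y n \<omega>) * (iexp (t * R n \<omega>) - 1)"
        by (simp add: algebra_simps exp_add)
      then have eq: "norm (iexp (t * (Y n \<omega> + R n \<omega>)) - iexp (t * Y n \<omega>)) = norm (iexp (t * R n \<omega>) - 1)"
        by (simp add: norm_mult)
      show ?thesis
      proof (cases "\<omega> \<in> A")
        case True
        have "norm (iexp (t * R n \<omega>) - 1) \<le> 2"
          using norm_triangle_ineq4[of "iexp (t * R n \<omega>)" 1] by simp
        moreover have "0 \<le> \<bar>t\<bar> * \<epsilon>" using \<open>\<epsilon> > 0\<close> by simp
        ultimately show ?thesis using True eq by simp
      next
        case False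
        have "norm (iexp (t * R n \<omega>) - 1) \<le> \<bar>t * R n \<omega>\<bar>"
          using iexp_approx1[of "t * R n \<omega>" 0] by simp
        also have "\<dots> \<le> \<bar>t\<bar> * \<epsilon>"
          using False that by (auto simp: A_def abs_mult intro!: mult_left_mono)
        finally show ?thesis using False eq by simp
      qed
    qed
    have int: "integrable M (\<lambda>\<omega>. iexp (t * f \<omega>))" if "f \<in> borel_measurable M" for f
      using that by (intro integrable_const_bound[where B=1]) auto
    have "norm (char (distr M borel (\<lambda>\<omega>. Y n \<omega> + R n \<omega>)) t - char (distr M borel (Y n)) t)
        = norm (\<integral>\<omega>. iexp (t * (Y n \<omega> + R n \<omega>)) - iexp (t * Y n \<omega>) \<partial>M)"
    proof -
      have char: "char (distr M borel f) t = (CLINT \<omega>|M. iexp (t * f \<omega>))"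
        if "f \<in> borel_measurable M" for f
        using that unfolding char_def by (subst integral_distr) auto
      show ?thesis
        by (subst (1 2) char, measurable)
          (subst Bochner_Integration.integral_diff, intro int, measurable, intro int, measurable)
    qed
    also have "\<dots> \<le> (\<integral>\<omega>. norm (iexp (t * (Y n \<omega> + R n \<omega>)) - iexp (t * Y n \<omega>)) \<partial>M)"
      by (rule integral_norm_bound)
    also have "\<dots> \<le> (\<integral>\<omega>. \<bar>t\<bar> * \<epsilon> + 2 * indicator A \<omega> \<partial>M)"
      by (intro integral_mono pt integrable_norm Bochner_Integration.integrable_diff int
          Bochner_Integration.integrable_add integrable_mult_right iA) (use A in simp_all)
    also have "\<dots> = \<bar>t\<bar> * \<epsilon> + 2 * prob A"
      using A iA by (subst Bochner_Integration.integral_add) (auto simp: prob_space)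
    finally show ?thesis unfolding A_def .
  qed
  have diff0: "(\<lambda>n. char (distr M borel (\<lambda>\<omega>. Y n \<omega> + R n \<omega>)) t - char (distr M borel (Y n)) t) \<longlonglongrightarrow> 0" for t
  proof (rule LIMSEQ_I)
    fix r :: real assume "r > 0"
    \<comment> \<open>The deterministic part of \<open>bound\<close> gets \<open>r / 2\<close> and
      the probability, which enters twice, gets \<open>r / 4\<close>. The \<open>+ 1\<close> avoids
      division by zero at \<open>t = 0\<close>.\<close>
    define \<epsilon> where "\<epsilon> = r / (2 * (\<bar>t\<bar> + 1))"
    have "\<epsilon> > 0" using \<open>r > 0\<close> by (simp add: \<epsilon>_def)
    have *: "\<bar>t\<bar> * \<epsilon> \<le> r / 2"
      using \<open>r > 0\<close> by (simp add: \<epsilon>_def field_simps)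
    have "(\<lambda>n. prob {\<omega>\<in>space M. \<bar>R n \<omega> - 0\<bar> > \<epsilon>}) \<longlonglongrightarrow> 0"
      using R \<open>\<epsilon> > 0\<close> by (simp add: converges_in_probability_def)
    then have "\<forall>\<^sub>F n in sequentially. prob {\<omega>\<in>space M. \<bar>R n \<omega> - 0\<bar> > \<epsilon>} < r / 4"
      using \<open>r > 0\<close> by (intro order_tendstoD) auto
    then obtain N where "\<And>n. n \<ge> N \<Longrightarrow> prob {\<omega>\<in>space M. \<bar>R n \<omega> - 0\<bar> > \<epsilon>} < r / 4"
      by (auto simp: eventually_sequentially)
    then have "norm (char (distr M borel (\<lambda>\<omega>. Y n \<omega> + R n \<omega>)) t - char (distr M borel (Y n)) t - 0) < r"
      if "n \<ge> N" for n
      using bound[OF \<open>\<epsilon> > 0\<close>, of n t] * that by fastforce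
    then show "\<exists>N. \<forall>n\<ge>N. norm (char (distr M borel (\<lambda>\<omega>. Y n \<omega> + R n \<omega>)) t - char (distr M borel (Y n)) t - 0) < r"
      by blast
  qed
  have "(\<lambda>n. char (distr M borel (\<lambda>\<omega>. Y n \<omega> + R n \<omega>)) t) \<longlonglongrightarrow> char \<nu> t" for t
    using tendsto_add[OF diff0[of t] char[of t]] by simp
  then have "weak_conv_m (\<lambda>n. distr M borel (\<lambda>\<omega>. Y n \<omega> + R n \<omega>)) \<nu>"
    by (intro levy_continuity) (auto simp: \<nu>)
  then show ?thesis by (simp add: converges_in_distribution_def)
qed

section \<open>Normal laws with possibly vanishing variance\<close>

lemma real_distribution_normal_distribution:
  assumes "v \<ge> 0" shows "real_distribution (normal_distribution m v)"
proof (cases "v = 0")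
  case True
  then show ?thesis
    by (auto simp: normal_distribution_def real_distribution_def real_distribution_axioms_def
        intro!: prob_space_return)
next
  case False
  then show ?thesis using assms
    by (auto simp: normal_distribution_def real_distribution_def real_distribution_axioms_def
        intro!: prob_space_normal_density)
qed

text \<open>Substituting \<open>sqrt v * x\<close> reduces positive variance to the standard normal
  law. For \<open>v = 0\<close> the law is a point mass at \<open>0\<close>, and both sides are
  1.\<close>

lemma char_normal_distribution_zero_mean:
  assumes "v \<ge> 0"
  shows "char (normal_distribution 0 v) t = complex_of_real (exp (- (v * t\<^sup>2) / 2))"
proof (cases "v = 0")
  case True
  then show ?thesis
    by (simp add: normal_distribution_def char_def integral_return)
next
  case False
  then have v: "sqrt v > 0" using assms by simp
  have "char (normal_distribution 0 v) t =
      (CLINT x|lborel. normal_density 0 (sqrt v) x *\<^sub>R iexp (t * x))"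
    using False by (simp add: normal_distribution_def char_def integral_density)
  also have "\<dots> = sqrt v *\<^sub>R (CLINT x|lborel. normal_density 0 (sqrt v) (0 + sqrt v * x) *\<^sub>R iexp (t * (0 + sqrt v * x)))"
    using v by (subst lborel_integral_real_affine[where c="sqrt v" and t=0]) auto
  also have "\<dots> = (CLINT x|lborel. std_normal_density x *\<^sub>R iexp ((t * sqrt v) * x))"
  proof (subst integral_scaleR_right[symmetric], intro Bochner_Integration.integral_cong refl)
    fix x :: real
    have "sqrt v * normal_density 0 (sqrt v) (0 + sqrt v * x) = std_normal_density x"
      using v assms by (simp add: normal_density_def power_mult_distrib real_sqrt_mult field_simps)
    then show "sqrt v *\<^sub>R normal_density 0 (sqrt v) (0 + sqrt v * x) *\<^sub>R iexp (t * (0 + sqrt v * x)) =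
        std_normal_density x *\<^sub>R iexp ((t * sqrt v) * x)"
      by (simp add: mult.assoc scaleR_scaleR del: of_real_mult)
  qed
  also have "\<dots> = char std_normal_distribution (t * sqrt v)"
    by (simp add: char_def integral_density)
  also have "\<dots> = complex_of_real (exp (- (v * t\<^sup>2) / 2))"
    using assms by (simp add: char_std_normal_distribution power_mult_distrib mult.commute)
  finally show ?thesis .
qed

text \<open>By induction on \<open>I\<close>: the new summand is independent of the sum of the
  others and centred, so the cross term integrates to 0. This is the variance computation behind
  Chebyshev's inequality below.\<close>

lemma (in prob_space) expectation_sum_square_indep:
  fixes Y :: "'i \<Rightarrow> 'a \<Rightarrow> real"
  assumes "finite I" "indep_vars (\<lambda>_. borel) Y I"
    and "\<And>i. i \<in> I \<Longrightarrow> integrable M (\<lambda>\<omega>. (Y i \<omega>)\<^sup>2)"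
    and "\<And>i. i \<in> I \<Longrightarrow> expectation (Y i) = 0"
  shows "integrable M (\<lambda>\<omega>. (\<Sum>i\<in>I. Y i \<omega>)\<^sup>2)"
    and "expectation (\<lambda>\<omega>. (\<Sum>i\<in>I. Y i \<omega>)\<^sup>2) = (\<Sum>i\<in>I. expectation (\<lambda>\<omega>. (Y i \<omega>)\<^sup>2))"
proof -
  have "integrable M (\<lambda>\<omega>. (\<Sum>i\<in>I. Y i \<omega>)\<^sup>2) \<and>
      expectation (\<lambda>\<omega>. (\<Sum>i\<in>I. Y i \<omega>)\<^sup>2) = (\<Sum>i\<in>I. expectation (\<lambda>\<omega>. (Y i \<omega>)\<^sup>2))"
    using assms
  proof (induction I rule: finite_induct)
    case (insert j I)
    let ?S = "\<lambda>\<omega>. \<Sum>i\<in>I. Y i \<omega>"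
    have rv[measurable]: "random_variable borel (Y i)" if "i \<in> insert j I" for i
      using insert.prems(1) that by (auto simp: indep_vars_def)
    have int: "integrable M (Y i)" if "i \<in> insert j I" for i
      using insert.prems(2) that rv by (auto intro: square_integrable_imp_integrable)
    have IH: "integrable M (\<lambda>\<omega>. (?S \<omega>)\<^sup>2)"
        "expectation (\<lambda>\<omega>. (?S \<omega>)\<^sup>2) = (\<Sum>i\<in>I. expectation (\<lambda>\<omega>. (Y i \<omega>)\<^sup>2))"
      using insert.IH insert.prems indep_vars_subset[OF insert.prems(1), of I] by auto
    have ind: "indep_var borel (Y j) borel ?S"
      using insert by (intro indep_vars_sum) auto
    have S: "integrable M ?S" using int by auto
    have prod: "integrable M (\<lambda>\<omega>. Y j \<omega> * ?S \<omega>)" "expectation (\<lambda>\<omega>. Y j \<omega> * ?S \<omega>) = 0"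
      using indep_var_integrable[OF ind] indep_var_lebesgue_integral[OF ind] int S insert.prems(3)
      by auto
    have eq: "(\<Sum>i\<in>insert j I. Y i \<omega>)\<^sup>2 = (Y j \<omega>)\<^sup>2 + 2 * (Y j \<omega> * ?S \<omega>) + (?S \<omega>)\<^sup>2" for \<omega>
      using insert.hyps by (simp add: power2_sum)
    show ?case
      unfolding eq using IH prod insert.prems(2) insert.hyps by simp
  qed simp
  then show "integrable M (\<lambda>\<omega>. (\<Sum>i\<in>I. Y i \<omega>)\<^sup>2)"
    "expectation (\<lambda>\<omega>. (\<Sum>i\<in>I. Y i \<omega>)\<^sup>2) = (\<Sum>i\<in>I. expectation (\<lambda>\<omega>. (Y i \<omega>)\<^sup>2))" by auto
qed

section \<open>Weak laws and the central limit theorem for averages of an iid sequence\<close>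

locale iid_sequence = prob_space M for M :: "'a measure" +
  fixes X :: "nat \<Rightarrow> 'a \<Rightarrow> real" and \<mu> :: "real measure"
  assumes indep: "indep_vars (\<lambda>_. borel) X UNIV"
    and distr_X: "\<And>i. distr M borel (X i) = \<mu>"
begin

lemma measurable_X[measurable]: "X i \<in> borel_measurable M"
  using indep by (auto simp: indep_vars_def)

lemma real_distribution_\<mu>: "real_distribution \<mu>"
  using real_distribution_distr[OF measurable_X[of 0]] by (simp add: distr_X)

sublocale \<mu>: cdf_distribution \<mu>
  unfolding cdf_distribution_def by (rule real_distribution_\<mu>)

lemma integrable_comp:
  fixes g :: "real \<Rightarrow> real"
  shows "g \<in> borel_measurable borel \<Longrightarrow> integrable M (\<lambda>\<omega>. g (X i \<omega>)) \<longleftrightarrow> integrable \<mu> g"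
  by (simp add: distr_X[of i, symmetric] integrable_distr_eq)

lemma expectation_comp:
  fixes g :: "real \<Rightarrow> real"
  shows "g \<in> borel_measurable borel \<Longrightarrow> expectation (\<lambda>\<omega>. g (X i \<omega>)) = \<mu>.expectation g"
  by (simp add: distr_X[of i, symmetric] integral_distr)

definition avg :: "(real \<Rightarrow> real) \<Rightarrow> nat \<Rightarrow> 'a \<Rightarrow> real" where
  "avg g n \<omega> = (\<Sum>i<n. g (X i \<omega>)) / real n"

lemma measurable_avg[measurable (raw)]:
  assumes [measurable]: "g \<in> borel_measurable borel"
  shows "avg g n \<in> borel_measurable M"
  unfolding avg_def[abs_def] by measurable

text \<open>Chebyshev's inequality. The bound is kept explicit in \<open>n\<close> and
  \<open>\<epsilon>\<close> because it is later applied with \<open>\<epsilon>\<close> of order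
  \<open>1 / sqrt n\<close>.\<close>

lemma prob_avg_deviation_le:
  assumes [measurable]: "g \<in> borel_measurable borel" and sq: "integrable \<mu> (\<lambda>x. (g x)\<^sup>2)"
    and "n > 0" "\<epsilon> > 0"
  shows "prob {\<omega>\<in>space M. \<epsilon> \<le> \<bar>avg g n \<omega> - \<mu>.expectation g\<bar>} \<le> \<mu>.variance g / (real n * \<epsilon>\<^sup>2)"
proof -
  define m where "m = \<mu>.expectation g"
  have g: "integrable \<mu> g"
    using sq by (rule \<mu>.square_integrable_imp_integrable[rotated]) simp
  have sq': "integrable \<mu> (\<lambda>x. (g x - m)\<^sup>2)"
    unfolding power2_diff using g sq by auto
  have ind: "indep_vars (\<lambda>_. borel) (\<lambda>i \<omega>. g (X i \<omega>) - m) {..<n}"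
    by (rule indep_vars_compose2[OF indep_vars_subset[OF indep]]) auto
  have mean0: "expectation (\<lambda>\<omega>. g (X i \<omega>) - m) = 0" for i
    using g by (subst expectation_comp[where g="\<lambda>x. g x - m"]) (auto simp: m_def \<mu>.prob_space[simplified])
  have var: "expectation (\<lambda>\<omega>. (g (X i \<omega>) - m)\<^sup>2) = \<mu>.variance g" for i
    by (subst expectation_comp[where g="\<lambda>x. (g x - m)\<^sup>2"]) (auto simp: m_def)
  have int: "integrable M (\<lambda>\<omega>. (g (X i \<omega>) - m)\<^sup>2)" for i
    using sq' integrable_comp[where g="\<lambda>x. (g x - m)\<^sup>2"] by simp
  note S = expectation_sum_square_indep[OF finite_lessThan ind int mean0]
  have eq: "avg g n \<omega> - m = (\<Sum>i<n. g (X i \<omega>) - m) / real n" for \<omega>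
    using \<open>n > 0\<close> by (simp add: avg_def sum_subtractf field_simps)
  have "prob {\<omega>\<in>space M. \<epsilon> \<le> \<bar>avg g n \<omega> - m\<bar>} \<le> expectation (\<lambda>\<omega>. (avg g n \<omega> - m)\<^sup>2) / \<epsilon>\<^sup>2"
    using S(1) \<open>\<epsilon> > 0\<close> by (intro second_moment_method) (auto simp: eq power_divide)
  also have "expectation (\<lambda>\<omega>. (avg g n \<omega> - m)\<^sup>2) = \<mu>.variance g / real n"
    unfolding eq power_divide using \<open>n > 0\<close> by (simp add: S(2) var) (simp add: power2_eq_square)
  finally show ?thesis
    by (simp add: m_def field_simps)
qed

lemma weak_law_square_integrable:
  assumes "g \<in> borel_measurable borel" "integrable \<mu> (\<lambda>x. (g x)\<^sup>2)" "\<epsilon> > 0"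
  shows "(\<lambda>n. prob {\<omega>\<in>space M. \<epsilon> \<le> \<bar>avg g n \<omega> - \<mu>.expectation g\<bar>}) \<longlonglongrightarrow> 0"
proof (rule tendsto_sandwich[OF _ _ tendsto_const])
  show "\<forall>\<^sub>F n in sequentially. prob {\<omega>\<in>space M. \<epsilon> \<le> \<bar>avg g n \<omega> - \<mu>.expectation g\<bar>}
      \<le> \<mu>.variance g / \<epsilon>\<^sup>2 / real n"
    using eventually_gt_at_top[of 0]
  proof eventually_elim
    case (elim n)
    then show ?case
      using prob_avg_deviation_le[OF assms(1,2) elim assms(3)] by (simp add: field_simps)
  qed
  show "(\<lambda>n. \<mu>.variance g / \<epsilon>\<^sup>2 / real n) \<longlonglongrightarrow> 0"
    by (rule lim_const_over_n)
qed auto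

lemma weak_law_nonneg:
  assumes [measurable]: "g \<in> borel_measurable borel" and int: "integrable \<mu> g"
    and nonneg: "\<And>x. g x \<ge> 0" and "\<epsilon> > 0"
  shows "(\<lambda>n. prob {\<omega>\<in>space M. \<epsilon> < \<bar>avg g n \<omega> - \<mu>.expectation g\<bar>}) \<longlonglongrightarrow> 0"
proof (rule LIMSEQ_I)
  fix r :: real assume "r > 0"
  \<comment> \<open>Only a first moment is available: apply Chebyshev to the truncation, Markov to the excess.\<close>
  define h where "h K x = min (g x) (real K)" for K x
  have h[measurable]: "h K \<in> borel_measurable borel" for K unfolding h_def by measurable
  have h_int: "integrable \<mu> (h K)" for K
    by (rule Bochner_Integration.integrable_bound[OF int]) (auto simp: h_def nonneg)
  have h_sq: "integrable \<mu> (\<lambda>x. (h K x)\<^sup>2)" for K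
  proof (rule \<mu>.integrable_const_bound[where B="(real K)\<^sup>2"])
    have "0 \<le> h K x \<and> h K x \<le> real K" for x by (auto simp: h_def nonneg)
    then show "AE x in \<mu>. norm ((h K x)\<^sup>2) \<le> (real K)\<^sup>2"
      by (auto intro!: power_mono)
  qed auto
  have "(\<lambda>K. \<mu>.expectation (h K)) \<longlonglongrightarrow> \<mu>.expectation g"
  proof (rule integral_dominated_convergence[OF _ _ int])
    show "AE x in \<mu>. (\<lambda>K. h K x) \<longlonglongrightarrow> g x"
    proof (intro AE_I2 tendsto_eventually)
      fix x
      obtain N :: nat where "g x \<le> real N" using real_arch_simple by blast
      then show "\<forall>\<^sub>F K in sequentially. h K x = g x"
        by (intro eventually_sequentiallyI[of N]) (auto simp: h_def min_def)
    qed
  qed (auto simp: h_def nonneg)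
  \<comment> \<open>The first bound keeps the change of mean due to truncation below a third of
    \<open>\<epsilon>\<close>. The second makes Markov's inequality for the excess \<open>d\<close>
    at level \<open>\<epsilon>/3\<close> yield at most \<open>r/2\<close>. The remaining third of
    \<open>\<epsilon>\<close> is left for the deviation of the truncated average.\<close>
  then have "\<forall>\<^sub>F K in sequentially. \<bar>\<mu>.expectation (h K) - \<mu>.expectation g\<bar> < min (\<epsilon>/3) (\<epsilon>/3 * (r/2))"
    unfolding tendsto_iff dist_real_def
    by (rule allE[where x="min (\<epsilon>/3) (\<epsilon>/3 * (r/2))"]) (use \<open>\<epsilon> > 0\<close> \<open>r > 0\<close> in simp)
  then obtain K where K: "\<bar>\<mu>.expectation (h K) - \<mu>.expectation g\<bar> < min (\<epsilon>/3) (\<epsilon>/3 * (r/2))"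
    by (auto dest: eventually_happens)
  define d where "d x = g x - h K x" for x
  have d[measurable]: "d \<in> borel_measurable borel" unfolding d_def by measurable
  have d_int: "integrable \<mu> d" unfolding d_def using int h_int by auto
  have d_nonneg: "d x \<ge> 0" for x by (simp add: d_def h_def)
  have Ed: "\<mu>.expectation d = \<mu>.expectation g - \<mu>.expectation (h K)"
    unfolding d_def using int h_int by simp
  have split: "avg g n \<omega> = avg (h K) n \<omega> + avg d n \<omega>" for n \<omega>
    by (simp add: avg_def d_def sum_subtractf diff_divide_distrib)
  let ?A = "\<lambda>n. {\<omega>\<in>space M. \<epsilon>/3 \<le> \<bar>avg (h K) n \<omega> - \<mu>.expectation (h K)\<bar>}"
  let ?B = "\<lambda>n. {\<omega>\<in>space M. \<epsilon>/3 \<le> avg d n \<omega>}"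
  have B: "prob (?B n) \<le> r / 2" for n
  proof -
    have d_comp: "integrable M (\<lambda>\<omega>. d (X i \<omega>))" for i
      using d_int integrable_comp by simp
    have "prob (?B n) \<le> expectation (avg d n) / (\<epsilon>/3)"
      using \<open>\<epsilon> > 0\<close> d_comp unfolding avg_def[abs_def]
      by (intro integral_Markov_inequality_measure[where A="{}"])
         (auto intro!: sum_nonneg divide_nonneg_nonneg simp: d_nonneg)
    \<comment> \<open>Equality holds for \<open>n > 0\<close>; at \<open>n = 0\<close> the average
      is \<open>0\<close> by convention, so only the inequality covers all \<open>n\<close>.\<close>
    also have "expectation (avg d n) \<le> \<mu>.expectation d"
      using d_comp unfolding avg_def[abs_def]
      by (cases "n = 0") (auto simp: expectation_comp d_nonneg intro!: integral_nonneg)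
    also have "\<dots> \<le> \<epsilon>/3 * (r/2)" using K Ed by linarith
    finally show ?thesis using \<open>\<epsilon> > 0\<close> by (simp add: divide_right_mono field_simps)
  qed
  have "(\<lambda>n. prob (?A n)) \<longlonglongrightarrow> 0"
    using \<open>\<epsilon> > 0\<close> by (intro weak_law_square_integrable h_sq) auto
  then have "\<forall>\<^sub>F n in sequentially. prob (?A n) < r/2"
    using \<open>r > 0\<close> by (intro order_tendstoD) auto
  then obtain N where N: "\<And>n. n \<ge> N \<Longrightarrow> prob (?A n) < r/2"
    by (auto simp: eventually_sequentially)
  have "prob {\<omega>\<in>space M. \<epsilon> < \<bar>avg g n \<omega> - \<mu>.expectation g\<bar>} \<le> prob (?A n) + prob (?B n)" for n
  proof -
    have "\<bar>avg d n \<omega>\<bar> = avg d n \<omega>" for \<omega>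
      by (intro abs_of_nonneg) (auto simp: avg_def d_nonneg intro!: sum_nonneg divide_nonneg_nonneg)
    then have "{\<omega>\<in>space M. \<epsilon> < \<bar>avg g n \<omega> - \<mu>.expectation g\<bar>} \<subseteq> ?A n \<union> ?B n"
      using K unfolding split by (auto simp: abs_if split: if_splits) (smt (verit) field_sum_of_halves)+
    then have "prob {\<omega>\<in>space M. \<epsilon> < \<bar>avg g n \<omega> - \<mu>.expectation g\<bar>} \<le> prob (?A n \<union> ?B n)"
      by (intro finite_measure_mono) auto
    also have "\<dots> \<le> prob (?A n) + prob (?B n)" by (intro measure_Un_le) auto
    finally show ?thesis .
  qed
  then show "\<exists>N. \<forall>n\<ge>N. norm (prob {\<omega>\<in>space M. \<epsilon> < \<bar>avg g n \<omega> - \<mu>.expectation g\<bar>} - 0) < r"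
    using N B by (intro exI[of _ N]) (smt (verit, best) diff_zero field_sum_of_halves measure_nonneg real_norm_def)
qed

text \<open>The central limit theorem normalises by the standard deviation, so zero variance is
  treated apart: there \<open>g (X i)\<close> is almost surely constant and all characteristic
  functions equal 1. The conclusion is put in the form that
  \<open>converges_in_distribution_add_vanishing\<close> takes.\<close>

lemma char_scaled_avg_tendsto:
  assumes [measurable]: "g \<in> borel_measurable borel" and sq: "integrable \<mu> (\<lambda>x. (g x)\<^sup>2)"
  shows "(\<lambda>n. char (distr M borel (\<lambda>\<omega>. sqrt (real n) * (avg g n \<omega> - \<mu>.expectation g))) t)
    \<longlonglongrightarrow> char (normal_distribution 0 (\<mu>.variance g)) t"
proof -
  define m where "m = \<mu>.expectation g"
  define v where "v = \<mu>.variance g"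
  have v0: "v \<ge> 0" by (simp add: v_def)
  have g: "integrable \<mu> g"
    using sq by (rule \<mu>.square_integrable_imp_integrable[rotated]) simp
  have sq': "integrable \<mu> (\<lambda>x. (g x - m)\<^sup>2)"
    unfolding power2_diff using g sq by auto
  \<comment> \<open>At \<open>n = 0\<close> both sides are \<open>0\<close>, by
    \<open>sqrt 0 = 0\<close> on the left and the empty sum on the right.\<close>
  have eq: "sqrt (real n) * (avg g n \<omega> - m) = (\<Sum>i<n. g (X i \<omega>) - m) / sqrt (real n)" for n \<omega>
  proof (cases "n = 0")
    case False
    define s where "s = sqrt (real n)"
    have "s > 0" "real n = s * s" using False by (simp_all add: s_def)
    then show ?thesis unfolding s_def[symmetric] avg_def sum_subtractf
      by (simp add: field_simps)
  qed (simp add: avg_def)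
  show ?thesis
  proof (cases "v = 0")
    case True
    have "AE x in \<mu>. (g x - m)\<^sup>2 = 0"
      using True sq' by (subst integral_nonneg_eq_0_iff_AE[symmetric]) (auto simp: v_def m_def)
    then have "AE x in distr M borel (X i). g x = m" for i
      by (subst distr_X) simp
    then have "AE \<omega> in M. \<forall>i. g (X i \<omega>) = m"
      by (subst (asm) AE_distr_iff) (auto simp: AE_all_countable)
    then have AE: "AE \<omega> in M. sqrt (real n) * (avg g n \<omega> - m) = 0" for n
      unfolding eq by eventually_elim simp
    have "char (distr M borel (\<lambda>\<omega>. sqrt (real n) * (avg g n \<omega> - m))) t = 1" for n
    proof -
      have "char (distr M borel (\<lambda>\<omega>. sqrt (real n) * (avg g n \<omega> - m))) t
          = (CLINT \<omega>|M. iexp (t * (sqrt (real n) * (avg g n \<omega> - m))))"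
        by (simp add: char_def integral_distr)
      also have "\<dots> = (CLINT \<omega>|M. 1)"
        using AE[of n] by (intro integral_cong_AE) auto
      finally show ?thesis by (simp add: prob_space)
    qed
    then show ?thesis
      using True by (simp add: char_normal_distribution_zero_mean m_def[symmetric] v_def[unfolded m_def[symmetric], symmetric])
  next
    case False
    then have v: "v > 0" using v0 by simp
    have "weak_conv_m (\<lambda>n. distr M borel (\<lambda>\<omega>. (\<Sum>i<n. g (X i \<omega>) - m) / sqrt (real n * (sqrt v)\<^sup>2))) std_normal_distribution"
    proof (rule central_limit_theorem_zero_mean[where \<mu>="distr \<mu> borel (\<lambda>x. g x - m)"])
      show "indep_vars (\<lambda>_. borel) (\<lambda>i \<omega>. g (X i \<omega>) - m) UNIV"
        by (rule indep_vars_compose2[OF indep]) auto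
      show mean0: "expectation (\<lambda>\<omega>. g (X i \<omega>) - m) = 0" for i
        using g by (subst expectation_comp[where g="\<lambda>x. g x - m"]) (auto simp: m_def \<mu>.prob_space[simplified])
      show "integrable M (\<lambda>\<omega>. (g (X i \<omega>) - m)\<^sup>2)" for i
        using sq' integrable_comp[where g="\<lambda>x. (g x - m)\<^sup>2"] by simp
      show "variance (\<lambda>\<omega>. g (X i \<omega>) - m) = (sqrt v)\<^sup>2" for i
        unfolding mean0 using v
        by (subst expectation_comp[where g="\<lambda>x. (g x - m - 0)\<^sup>2"]) (auto simp: m_def v_def)
      show "distr M borel (\<lambda>\<omega>. g (X i \<omega>) - m) = distr \<mu> borel (\<lambda>x. g x - m)" for i
        by (subst distr_X[of i, symmetric], subst distr_distr) (auto simp: comp_def)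
    qed (use v in auto)
    \<comment> \<open>Evaluation at \<open>t * sqrt v\<close> undoes the division by the standard
      deviation \<open>sqrt v\<close>.\<close>
    then have "(\<lambda>n. char (distr M borel (\<lambda>\<omega>. (\<Sum>i<n. g (X i \<omega>) - m) / sqrt (real n * (sqrt v)\<^sup>2))) (t * sqrt v))
        \<longlonglongrightarrow> char std_normal_distribution (t * sqrt v)"
      by (intro levy_continuity1) (auto intro: real_dist_normal_dist)
    moreover have "char (distr M borel (\<lambda>\<omega>. (\<Sum>i<n. g (X i \<omega>) - m) / sqrt (real n * (sqrt v)\<^sup>2))) (t * sqrt v)
        = char (distr M borel (\<lambda>\<omega>. sqrt (real n) * (avg g n \<omega> - m))) t" for n
    proof -
      have "t * sqrt v * (s / sqrt (real n * (sqrt v)\<^sup>2)) = t * (s / sqrt (real n))" for s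
        using v by (simp add: real_sqrt_mult)
      then show ?thesis
        unfolding char_def eq by (subst (1 2) integral_distr) auto
    qed
    moreover have "char std_normal_distribution (t * sqrt v) = char (normal_distribution 0 v) t"
      using v by (simp add: char_std_normal_distribution char_normal_distribution_zero_mean
          power_mult_distrib mult.commute)
    ultimately show ?thesis by (simp add: m_def v_def)
  qed
qed

end

section \<open>The variational formula for TVaR\<close>

context real_distribution
begin

text \<open>For fixed \<open>t\<close>, the integral over \<open>x\<close> of the indicator of
  \<open>{t..q}\<close> is \<open>max (q - t) 0\<close>; Fubini exchanges it with the expectation.
  The weight \<open>h\<close> is left free because the variance formula needs three different
  choices of it.\<close>

lemma integral_shortfall:
  assumes [measurable]: "h \<in> borel_measurable borel" and h0: "\<And>t. h t \<ge> 0"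
    and int: "integrable M (\<lambda>t. h t * max (q - t) 0)"
  shows "integrable lborel (\<lambda>x. indicator {..q} x * expectation (\<lambda>t. h t * indicator {..x} t))"
    and "(LBINT x. indicator {..q} x * expectation (\<lambda>t. h t * indicator {..x} t))
      = expectation (\<lambda>t. h t * max (q - t) 0)"
proof -
  interpret P: pair_sigma_finite M lborel
    by (intro pair_sigma_finite.intro sigma_finite_measure_axioms lborel.sigma_finite_measure_axioms)
  define f :: "real \<times> real \<Rightarrow> real" where "f = (\<lambda>(t, x). if t \<le> x \<and> x \<le> q then h t else 0)"
  have eq: "f (t, x) = h t * indicator {t..q} x" for t x
    by (auto simp: f_def indicator_def)
  have "f \<in> borel_measurable (borel \<Otimes>\<^sub>M borel)"
    unfolding f_def by measurable
  then have f_meas[measurable]: "f \<in> borel_measurable (M \<Otimes>\<^sub>M lborel)"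
    by (subst measurable_cong_sets[OF sets_pair_measure_cong[OF events_eq_borel sets_lborel] refl])
  have inner: "(LBINT x. f (t, x)) = h t * max (q - t) 0" for t
    unfolding eq by (cases "t \<le> q") auto
  have f_int: "integrable (M \<Otimes>\<^sub>M lborel) f"
  proof (rule P.Fubini_integrable)
    have "norm (f (t, x)) = f (t, x)" for t x by (simp add: eq h0)
    then show "integrable M (\<lambda>t. LBINT x. norm (f (t, x)))" by (simp add: inner int)
    show "AE t in M. integrable lborel (\<lambda>x. f (t, x))"
      unfolding eq by (intro AE_I2 integrable_mult_right integrable_real_indicator) (auto simp: emeasure_lborel_Icc_eq)
  qed auto
  have outer: "expectation (\<lambda>t. f (t, x)) = indicator {..q} x * expectation (\<lambda>t. h t * indicator {..x} t)" for x
    by (subst Bochner_Integration.integral_mult_right_zero[symmetric], rule Bochner_Integration.integral_cong)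
      (auto simp: f_def indicator_def)
  show "integrable lborel (\<lambda>x. indicator {..q} x * expectation (\<lambda>t. h t * indicator {..x} t))"
    using P.integrable_snd[of "\<lambda>t x. f (t, x)"] f_int by (simp add: outer)
  have "(LBINT x. expectation (\<lambda>t. f (t, x))) = expectation (\<lambda>t. LBINT x. f (t, x))"
    using P.integral_fst'[OF f_int] P.integral_snd[of "\<lambda>t x. f (t, x)"] f_int by simp
  then show "(LBINT x. indicator {..q} x * expectation (\<lambda>t. h t * indicator {..x} t))
      = expectation (\<lambda>t. h t * max (q - t) 0)"
    by (simp add: inner outer)
qed

end

section \<open>The quantile function as a random variable on the unit interval\<close>

context cdf_distribution
begin

abbreviation "\<Omega> \<equiv> restrict_space lborel {0<..<1::real}"

text \<open>The library only has the quantile as an abbreviation, which the simplifier would unfold into.\<close>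

definition Q :: "real \<Rightarrow> real" where "Q u = Inf {x. u \<le> C x}"

lemma Q_le_iff: "0 < u \<Longrightarrow> u < 1 \<Longrightarrow> Q u \<le> x \<longleftrightarrow> u \<le> C x"
  using pseudoinverse[of u x] by (simp add: Q_def)

lemma mono_Q: "mono_on {0<..<1} Q"
  using mono_I by (simp add: mono_on_def Q_def)

lemma measurable_Q[measurable]: "Q \<in> borel_measurable \<Omega>"
  using measurable_CI unfolding Q_def[abs_def]
  by (simp cong: measurable_cong_sets add: sets_restrict_space)

text \<open>The inverse transform: it turns integrals over levels \<open>u\<close> into expectations
  under \<open>M\<close>.\<close>

lemma distr_Q: "distr \<Omega> borel Q = M"
  using distr_I_eq_M by (simp add: Q_def[abs_def])

text \<open>By \<open>Q_le_iff\<close> the set under the infimum is nonempty and bounded below, so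
  its infima in the reals and in the extended reals agree.\<close>

lemma quantile_eq_Q:
  assumes "0 < u" "u < 1"
  shows "quantile C u = ereal (Q u)"
proof -
  have ex: "\<exists>x. u \<le> C x" using Q_le_iff[OF assms] by blast
  have "bdd_below {x. u \<le> C x}"
    by (rule bdd_belowI[of _ "Q u"]) (simp add: Q_le_iff[OF assms])
  with ex have "ereal (Inf {x. u \<le> C x}) = (INF x\<in>{x. u \<le> C x}. ereal x)"
    by (intro ereal_Inf') auto
  then show ?thesis using assms by (simp add: quantile_def Q_def)
qed

lemma integral_comp_Q:
  fixes f :: "real \<Rightarrow> real"
  assumes [measurable]: "f \<in> borel_measurable borel"
  shows "(\<integral>u. f (Q u) \<partial>\<Omega>) = expectation f"
  by (subst distr_Q[symmetric], subst integral_distr) auto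

lemma integrable_comp_Q:
  fixes f :: "real \<Rightarrow> real"
  assumes [measurable]: "f \<in> borel_measurable borel"
  shows "integrable \<Omega> (\<lambda>u. f (Q u)) \<longleftrightarrow> integrable M f"
  by (subst (2) distr_Q[symmetric], subst integrable_distr_eq) auto

lemma tvar_eq_integral_Q:
  assumes "0 < p" "p < 1"
  shows "p * tvar C p = (\<integral>u. indicator {..p} u * Q u \<partial>\<Omega>)"
proof -
  let ?J = "\<lambda>u. indicator {0<..<1} u *\<^sub>R (indicator {..p} u * Q u)"
  have J: "?J \<in> borel_measurable lborel"
    by (rule borel_measurable_restrict_space_iff[THEN iffD1])
      (simp, intro borel_measurable_times measurable_Q measurable_restrict_space1, simp)
  \<comment> \<open>The level \<open>0\<close> belongs to \<open>{0..p}\<close> but not to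
    \<open>\<Omega>\<close>. Its contribution is split off as a term supported on a null
    set.\<close>
  have "(LBINT u:{0..p}. real_of_ereal (quantile C u))
      = (LBINT u. ?J u + indicator {0} u * real_of_ereal (quantile C 0))"
    unfolding set_lebesgue_integral_def using assms
    by (intro Bochner_Integration.integral_cong) (auto simp: indicator_def quantile_eq_Q)
  also have "\<dots> = (LBINT u. ?J u)"
    using J AE_lborel_singleton[of 0] by (intro integral_cong_AE) auto
  also have "\<dots> = (\<integral>u. indicator {..p} u * Q u \<partial>\<Omega>)"
    by (subst integral_restrict_space) auto
  finally show ?thesis using assms by (simp add: tvar_def)
qed

lemma integrable_shortfall:
  assumes "integrable M (\<lambda>t. max (- t) 0)"
  shows "integrable M (\<lambda>t. max (x - t) 0)"
proof (rule Bochner_Integration.integrable_bound)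
  show "integrable M (\<lambda>t. max (- t) 0 + \<bar>x\<bar>)" using assms by simp
qed auto

lemma integrable_shortfall_square:
  assumes "integrable M (\<lambda>t. (max (- t) 0)\<^sup>2)"
  shows "integrable M (\<lambda>t. (max (x - t) 0)\<^sup>2)"
proof (rule Bochner_Integration.integrable_bound)
  show "integrable M (\<lambda>t. 2 * (max (- t) 0)\<^sup>2 + 2 * x\<^sup>2)" using assms by simp
  show "AE t in M. norm ((max (x - t) 0)\<^sup>2) \<le> norm (2 * (max (- t) 0)\<^sup>2 + 2 * x\<^sup>2)"
  proof (rule AE_I2)
    fix t
    have "(max (x - t) 0)\<^sup>2 \<le> (max (- t) 0 + \<bar>x\<bar>)\<^sup>2" by (intro power_mono) auto
    also have "\<dots> \<le> 2 * (max (- t) 0)\<^sup>2 + 2 * x\<^sup>2"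
      using sum_squares_bound[of "max (- t) 0" "\<bar>x\<bar>"] by (simp add: power2_sum)
    finally show "norm ((max (x - t) 0)\<^sup>2) \<le> norm (2 * (max (- t) 0)\<^sup>2 + 2 * x\<^sup>2)" by simp
  qed
qed auto

section \<open>TVaR as the maximum of a concave objective\<close>

context
  fixes p :: real
  assumes neg: "integrable M (\<lambda>t. max (- t) 0)" and p: "0 < p" "p < 1"
begin

text \<open>Writing \<open>p * x\<close> as the integral of the constant \<open>x\<close> over
  levels up to \<open>p\<close> turns the gap into one integral, which can be compared pointwise
  with the shortfall \<open>max (x - Q u) 0\<close>.\<close>

lemma tvar_dual_gap:
  "integrable \<Omega> (\<lambda>u. indicator {..p} u * (x - Q u))"
  "p * x - p * tvar C p = (\<integral>u. indicator {..p} u * (x - Q u) \<partial>\<Omega>)"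
proof -
  interpret \<Omega>: prob_space \<Omega>
    by (auto simp: emeasure_restrict_space space_restrict_space intro!: prob_spaceI)
  have negI: "integrable \<Omega> (\<lambda>u. max (- Q u) 0)"
    using neg by (subst integrable_comp_Q) auto
  have int: "integrable \<Omega> (\<lambda>u. indicator {..p} u * Q u)"
  proof (rule Bochner_Integration.integrable_bound)
    \<comment> \<open>Up to level \<open>p\<close> the quantile is at most \<open>Q p\<close>, so
      its positive part is bounded and only the negative part needs the moment hypothesis.\<close>
    show "integrable \<Omega> (\<lambda>u. max (- Q u) 0 + \<bar>Q p\<bar>)" using negI by simp
    show "AE u in \<Omega>. norm (indicator {..p} u * Q u) \<le> norm (max (- Q u) 0 + \<bar>Q p\<bar>)"
    proof (rule AE_I2)
      fix u assume "u \<in> space \<Omega>"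
      then have "u \<le> p \<Longrightarrow> Q u \<le> Q p"
        using mono_onD[OF mono_Q, of u p] p by (auto simp: space_restrict_space)
      then show "norm (indicator {..p} u * Q u) \<le> norm (max (- Q u) 0 + \<bar>Q p\<bar>)"
        by (auto simp: indicator_def)
    qed
  qed (intro borel_measurable_times measurable_Q measurable_restrict_space1, simp)
  have x: "integrable \<Omega> (\<lambda>u. indicator {..p} u * x)"
    by (rule \<Omega>.integrable_const_bound[where B="\<bar>x\<bar>"])
      (auto simp: indicator_def intro!: measurable_restrict_space1)
  show "integrable \<Omega> (\<lambda>u. indicator {..p} u * (x - Q u))"
    using int x by (simp add: right_diff_distrib)
  have "(\<integral>u. indicator {..p} u * x \<partial>\<Omega>) = (LBINT u. indicator {0<..p} u * x)"
    by (subst integral_restrict_space, simp, intro Bochner_Integration.integral_cong)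
      (use p in \<open>auto simp: indicator_def\<close>)
  also have "\<dots> = p * x" using p by simp
  finally have px: "(\<integral>u. indicator {..p} u * x \<partial>\<Omega>) = p * x" .
  show "p * x - p * tvar C p = (\<integral>u. indicator {..p} u * (x - Q u) \<partial>\<Omega>)"
    unfolding tvar_eq_integral_Q[OF p] right_diff_distrib
    by (simp only: Bochner_Integration.integral_diff[OF x int] px)
qed

text \<open>The integrand of \<open>tvar_dual_gap\<close> never exceeds
  \<open>max (x - Q u) 0\<close>, and \<open>Q\<close> has law \<open>M\<close>.\<close>

lemma tvar_ge: "p * x - expectation (\<lambda>t. max (x - t) 0) \<le> p * tvar C p"
proof -
  have "(\<integral>u. indicator {..p} u * (x - Q u) \<partial>\<Omega>) \<le> (\<integral>u. max (x - Q u) 0 \<partial>\<Omega>)"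
    using integrable_shortfall[OF neg, of x] integrable_comp_Q[of "\<lambda>t. max (x - t) 0"]
    by (intro integral_mono tvar_dual_gap) (auto simp: indicator_def)
  then show ?thesis
    using integral_comp_Q[of "\<lambda>t. max (x - t) 0"] tvar_dual_gap(2)[of x] by simp
qed

text \<open>At \<open>x = Q p\<close> the pointwise comparison is an equality: by monotonicity
  \<open>Q p - Q u\<close> is nonnegative for \<open>u \<le> p\<close> and nonpositive for
  \<open>u \<ge> p\<close>.\<close>

lemma tvar_eq: "p * tvar C p = p * Q p - expectation (\<lambda>t. max (Q p - t) 0)"
proof -
  have "(\<integral>u. indicator {..p} u * (Q p - Q u) \<partial>\<Omega>) = (\<integral>u. max (Q p - Q u) 0 \<partial>\<Omega>)"
  proof (rule Bochner_Integration.integral_cong[OF refl])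
    fix u assume "u \<in> space \<Omega>"
    then have "u \<le> p \<Longrightarrow> Q u \<le> Q p" "u \<ge> p \<Longrightarrow> Q p \<le> Q u"
      using mono_onD[OF mono_Q, of u p] mono_onD[OF mono_Q, of p u] p
      by (auto simp: space_restrict_space)
    then show "indicator {..p} u * (Q p - Q u) = max (Q p - Q u) 0"
      by (auto simp: indicator_def)
  qed
  then show ?thesis
    using integral_comp_Q[of "\<lambda>t. max (Q p - t) 0"] tvar_dual_gap(2)[of "Q p"] by simp
qed

end

text \<open>The indicator of \<open>{..Q p}\<close> has mean \<open>C (Q p)\<close>, which exceeds
  \<open>p\<close> if an atom at \<open>Q p\<close> overshoots. Counting only a fraction of the atom
  corrects the mean, so that \<open>avg z\<close> later fluctuates around exactly
  \<open>p\<close>.\<close>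

lemma exists_quantile_weight:
  assumes p: "0 < p" "p < 1"
  obtains z :: "real \<Rightarrow> real" where "z \<in> borel_measurable borel" "\<And>t. 0 \<le> z t" "\<And>t. z t \<le> 1"
    "\<And>t. t < Q p \<Longrightarrow> z t = 1" "\<And>t. Q p < t \<Longrightarrow> z t = 0" "expectation z = p"
proof -
  let ?q = "Q p"
  have up: "p \<le> C ?q" using Q_le_iff[OF p, of ?q] by simp
  \<comment> \<open>Left of \<open>Q p\<close> the cdf stays below \<open>p\<close>, and the bound
    passes to the left limit.\<close>
  have lo: "measure M {..<?q} \<le> p"
  proof (rule tendsto_upperbound[OF cdf_at_left])
    show "\<forall>\<^sub>F x in at_left ?q. C x \<le> p"
    proof (rule eventually_at_leftI[of "?q - 1"])
      show "C x \<le> p" if "x \<in> {?q - 1<..<?q}" for x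
        using Q_le_iff[OF p, of x] that by simp
    qed simp
  qed simp
  have "C ?q = measure M ({..<?q} \<union> {?q})"
    unfolding cdf_def by (rule arg_cong[where f="measure M"]) auto
  also have "\<dots> = measure M {..<?q} + measure M {?q}"
    by (rule finite_measure_Union) auto
  finally have C: "C ?q = measure M {..<?q} + measure M {?q}" .
  \<comment> \<open>The share of the atom that supplies the missing mass
    \<open>p - measure M {..<?q}\<close>. Without an atom, \<open>lo\<close> and \<open>up\<close>
    leave nothing missing and \<open>0\<close> serves.\<close>
  define \<theta> where "\<theta> = (if measure M {?q} = 0 then 0 else (p - measure M {..<?q}) / measure M {?q})"
  have \<theta>: "0 \<le> \<theta>" "\<theta> \<le> 1" "measure M {..<?q} + \<theta> * measure M {?q} = p"
  proof -
    have "(p - l) / m \<ge> 0 \<and> (p - l) / m \<le> 1 \<and> l + (p - l) / m * m = p"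
      if "m > 0" "l \<le> p" "p \<le> l + m" for l m :: real
      using that by (auto simp: field_simps)
    from this[of "measure M {?q}", OF _ lo] show "0 \<le> \<theta>" "\<theta> \<le> 1" "measure M {..<?q} + \<theta> * measure M {?q} = p"
      using up lo C measure_nonneg[of M "{?q}"] unfolding \<theta>_def by (auto simp: less_le)
  qed
  define z :: "real \<Rightarrow> real" where "z t = indicator {..<?q} t + \<theta> * indicator {?q} t" for t
  show ?thesis
  proof
    show "z \<in> borel_measurable borel" unfolding z_def[abs_def] by measurable
    show "expectation z = p"
      unfolding z_def[abs_def] using \<theta>(3)
      by (subst Bochner_Integration.integral_add) (auto simp: emeasure_eq_measure)
  qed (use \<theta> in \<open>auto simp: z_def indicator_def\<close>)
qed

text \<open>If \<open>C x \<le> p\<close>, every level \<open>u > p\<close> would have its quantile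
  beyond \<open>x\<close>, so the quantile function would jump at \<open>p\<close>. The lemma makes
  arbitrarily narrow brackets around \<open>Q p\<close> available.\<close>

lemma less_cdf_if_isCont_quantile:
  assumes p: "0 < p" "p < 1" and cont: "isCont (quantile C) p" and x: "Q p < x"
  shows "p < C x"
proof (rule ccontr)
  assume "\<not> p < C x"
  have "(quantile C \<longlongrightarrow> ereal (Q p)) (at_right p)"
    using cont p by (auto simp: continuous_at quantile_eq_Q intro: filterlim_at_split[THEN iffD1, THEN conjunct2])
  then have "\<forall>\<^sub>F u in at_right p. quantile C u < ereal x"
    using x by (intro order_tendstoD) auto
  moreover have "\<forall>\<^sub>F u in at_right p. p < u \<and> u < 1"
    using p by (auto simp: eventually_at_right[of _ 1])
  ultimately have "\<forall>\<^sub>F u in at_right p. False"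
  proof eventually_elim
    case (elim u)
    then have "Q u < x" using p by (simp add: quantile_eq_Q)
    then have "u \<le> C x" using Q_le_iff[of u x] elim p by simp
    then show ?case using elim \<open>\<not> p < C x\<close> by simp
  qed
  then show False by simp
qed

text \<open>With \<open>W\<close> the shortfall below \<open>Q p\<close>, integrating
  \<open>C (min x y)\<close> over \<open>x\<close> and then over \<open>y\<close> gives the second
  moment of \<open>W\<close> by two uses of \<open>integral_shortfall\<close>; a third use turns the
  product term into the squared mean.\<close>

lemma tvar_variance_eq:
  assumes p: "0 < p" "p < 1" and sq: "integrable M (\<lambda>t. (max (- t) 0)\<^sup>2)"
  shows "tvar_variance C p = variance (\<lambda>t. max (Q p - t) 0) / p\<^sup>2"
proof -
  define q where "q = Q p"
  define W where "W t = max (q - t) 0" for t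
  have [measurable]: "W \<in> borel_measurable borel" unfolding W_def[abs_def] by measurable
  have W0: "W t \<ge> 0" for t by (simp add: W_def)
  have W2: "integrable M (\<lambda>t. W t * W t)"
    using integrable_shortfall_square[OF sq, of q] by (simp add: W_def power2_eq_square)
  have W: "integrable M W"
    using W2 by (intro square_integrable_imp_integrable[of W]) (auto simp: power2_eq_square)
  have iW: "integrable M (\<lambda>t. indicator {..y} t * W t)" for y
    using integrable_mult_indicator[OF _ W, of "{..y}"] by simp
  have E1: "expectation (\<lambda>t. 1 * indicator {..x} t) = C x" for x
    by (simp add: cdf_def)
  have E2: "expectation (\<lambda>t. indicator {..y} t * indicator {..x} t) = C (min x y)" for x y
  proof -
    have "indicator {..y} t * indicator {..x} t = (indicator {..min x y} t :: real)" for t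
      by (auto simp: indicator_def)
    then show ?thesis by (simp add: cdf_def)
  qed
  note S1 = integral_shortfall[of "\<lambda>_. 1" q, unfolded W_def[symmetric] E1]
  have S1': "integrable lborel (\<lambda>x. indicator {..q} x * C x)"
    "(LBINT x. indicator {..q} x * C x) = expectation W"
    using S1 W by simp_all
  have S2: "integrable lborel (\<lambda>x. indicator {..q} x * C (min x y))"
    "(LBINT x. indicator {..q} x * C (min x y)) = expectation (\<lambda>t. W t * indicator {..y} t)" for y
    using integral_shortfall[of "indicator {..y}" q, unfolded W_def[symmetric] E2] iW[of y]
    by (simp_all add: mult.commute)
  have S3: "integrable lborel (\<lambda>y. indicator {..q} y * expectation (\<lambda>t. W t * indicator {..y} t))"
    "(LBINT y. indicator {..q} y * expectation (\<lambda>t. W t * indicator {..y} t)) = expectation (\<lambda>t. W t * W t)"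
    using integral_shortfall[of W q, unfolded W_def[symmetric]] W2 W0 by simp_all
  have inner: "(LBINT x:{..q}. C (min x y) - C x * C y) = expectation (\<lambda>t. W t * indicator {..y} t) - expectation W * C y" for y
  proof -
    have "(LBINT x:{..q}. C (min x y) - C x * C y) = (LBINT x. indicator {..q} x * C (min x y) - indicator {..q} x * C x * C y)"
      unfolding set_lebesgue_integral_def by (simp add: algebra_simps)
    also have "\<dots> = expectation (\<lambda>t. W t * indicator {..y} t) - expectation W * C y"
      using S2 S1' by (subst Bochner_Integration.integral_diff) auto
    finally show ?thesis .
  qed
  have "(LBINT y:{..q}. (LBINT x:{..q}. C (min x y) - C x * C y))
      = (LBINT y. indicator {..q} y * expectation (\<lambda>t. W t * indicator {..y} t) - expectation W * (indicator {..q} y * C y))"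
    unfolding inner unfolding set_lebesgue_integral_def by (simp add: algebra_simps)
  also have "\<dots> = expectation (\<lambda>t. W t * W t) - expectation W * expectation W"
    using S3 S1' by (subst Bochner_Integration.integral_diff) auto
  also have "\<dots> = variance W"
    using W W2 by (subst variance_eq) (auto simp: power2_eq_square)
  finally show ?thesis
    by (simp add: tvar_variance_def quantile_eq_Q[OF p] flip: q_def W_def)
qed

end

section \<open>The empirical TVaR\<close>

text \<open>The pushforward of the uniform law on indices, so that the duality results above apply
  to each sample. The uniform law on an empty index set carries no meaning, hence
  \<open>n > 0\<close> in the lemmas that evaluate this measure.\<close>

definition empirical_measure :: "(nat \<Rightarrow> real) \<Rightarrow> nat \<Rightarrow> real measure" where
  "empirical_measure x n = distr (measure_pmf (pmf_of_set {..<n})) borel x"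

lemma real_distribution_empirical_measure: "real_distribution (empirical_measure x n)"
  unfolding empirical_measure_def
  by (intro prob_space.real_distribution_distr measure_pmf.prob_space_axioms) simp

lemma
  fixes f :: "real \<Rightarrow> real"
  assumes [measurable]: "f \<in> borel_measurable borel" and "n > 0"
  shows integrable_empirical_measure: "integrable (empirical_measure x n) f"
    and integral_empirical_measure: "(\<integral>t. f t \<partial>empirical_measure x n) = (\<Sum>i<n. f (x i)) / real n"
proof -
  have ne: "{..<n} \<noteq> {}" using assms by auto
  show "integrable (empirical_measure x n) f"
    unfolding empirical_measure_def using ne
    by (subst integrable_distr_eq) (simp_all add: integrable_measure_pmf_finite)
  show "(\<integral>t. f t \<partial>empirical_measure x n) = (\<Sum>i<n. f (x i)) / real n"
    unfolding empirical_measure_def using ne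
    by (subst integral_distr) (auto simp: integral_pmf_of_set)
qed

lemma cdf_empirical_measure:
  assumes "n > 0"
  shows "cdf (empirical_measure (\<lambda>i. X i \<omega>) n) = empirical_cdf X n \<omega>"
proof
  fix y
  interpret real_distribution "empirical_measure (\<lambda>i. X i \<omega>) n"
    by (rule real_distribution_empirical_measure)
  have "cdf (empirical_measure (\<lambda>i. X i \<omega>) n) y = expectation (indicator {..y})"
    by (simp add: cdf_def)
  also have "\<dots> = (\<Sum>i<n. indicator {..y} (X i \<omega>)) / real n"
    using assms by (intro integral_empirical_measure) auto
  finally show "cdf (empirical_measure (\<lambda>i. X i \<omega>) n) y = empirical_cdf X n \<omega> y"
    by (simp add: empirical_cdf_def)
qed

section \<open>The empirical objective and its maximiser\<close>

context iid_sequence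
begin

lemma empirical_cdf_eq_avg: "empirical_cdf X n \<omega> x = avg (indicator {..x}) n \<omega>"
  by (simp add: empirical_cdf_def avg_def)

context
  fixes p :: real
  assumes p: "0 < p" "p < 1"
begin

text \<open>The Rockafellar-Uryasev objective of the sample.\<close>

abbreviation dual :: "real \<Rightarrow> nat \<Rightarrow> 'a \<Rightarrow> real" where
  "dual x n \<omega> \<equiv> p * x - avg (\<lambda>t. max (x - t) 0) n \<omega>"

lemma dual_le_tvar_empirical:
  assumes "n > 0"
  shows "dual x n \<omega> \<le> p * tvar (empirical_cdf X n \<omega>) p"
proof -
  interpret E: cdf_distribution "empirical_measure (\<lambda>i. X i \<omega>) n"
    unfolding cdf_distribution_def by (rule real_distribution_empirical_measure)
  show ?thesis
    using E.tvar_ge[OF integrable_empirical_measure p, of x] assms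
    by (simp add: cdf_empirical_measure integral_empirical_measure avg_def)
qed

text \<open>The maximiser is the empirical quantile. It is exposed through its order
  characterisation, so that values of the empirical cdf suffice to locate it.\<close>

lemma tvar_empirical_attained:
  assumes "n > 0"
  obtains x where "p * tvar (empirical_cdf X n \<omega>) p = dual x n \<omega>"
    "\<And>y. x \<le> y \<longleftrightarrow> p \<le> empirical_cdf X n \<omega> y"
proof -
  interpret E: cdf_distribution "empirical_measure (\<lambda>i. X i \<omega>) n"
    unfolding cdf_distribution_def by (rule real_distribution_empirical_measure)
  show ?thesis
  proof
    show "p * tvar (empirical_cdf X n \<omega>) p = dual (E.Q p) n \<omega>"
      using E.tvar_eq[OF integrable_empirical_measure p] assms
      by (simp add: cdf_empirical_measure integral_empirical_measure avg_def)
    show "E.Q p \<le> y \<longleftrightarrow> p \<le> empirical_cdf X n \<omega> y" for y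
      using E.Q_le_iff[OF p, of y] assms by (simp add: cdf_empirical_measure)
  qed
qed

text \<open>The objective is continuous in \<open>x\<close>, so its maximum exceeds \<open>c\<close>
  iff its value at some rational does; this gives a countable union of measurable sets.\<close>

lemma measurable_tvar_empirical: "(\<lambda>\<omega>. tvar (empirical_cdf X n \<omega>) p) \<in> borel_measurable M"
proof (cases "n = 0")
  case True
  \<comment> \<open>With no observations the TVaR, whatever its value, does not depend on
    \<open>\<omega>\<close>.\<close>
  then have "empirical_cdf X n = (\<lambda>\<omega> x. 0)"
    by (simp add: empirical_cdf_def fun_eq_iff)
  then show ?thesis by simp
next
  case False
  have "(\<lambda>\<omega>. p * tvar (empirical_cdf X n \<omega>) p) \<in> borel_measurable M"
  proof (rule borel_measurableI_greater)
    fix c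
    have "{\<omega>\<in>space M. c < p * tvar (empirical_cdf X n \<omega>) p} = (\<Union>r\<in>\<rat>. {\<omega>\<in>space M. c < dual r n \<omega>})"
    proof (intro set_eqI iffI)
      fix \<omega> assume \<omega>: "\<omega> \<in> {\<omega>\<in>space M. c < p * tvar (empirical_cdf X n \<omega>) p}"
      obtain x where "p * tvar (empirical_cdf X n \<omega>) p = dual x n \<omega>"
        using tvar_empirical_attained False by blast
      with \<omega> have x: "c < dual x n \<omega>" by simp
      have "isCont (\<lambda>x. dual x n \<omega>) x"
        unfolding avg_def using False by (intro continuous_intros) auto
      then have "\<forall>\<^sub>F y in at x. c < dual y n \<omega>"
        using x by (intro order_tendstoD(1)) (auto simp: isCont_def)
      then obtain d where "d > 0" "\<And>y. y \<noteq> x \<Longrightarrow> dist y x < d \<Longrightarrow> c < dual y n \<omega>"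
        by (auto simp: eventually_at)
      \<comment> \<open>Strictly above \<open>x\<close>, because the neighbourhood obtained from
        \<open>at x\<close> is punctured.\<close>
      moreover obtain r where "r \<in> \<rat>" "x < r" "r < x + d"
        using Rats_dense_in_real[of x "x + d"] \<open>d > 0\<close> by auto
      ultimately have "c < dual r n \<omega>" by (auto simp: dist_real_def)
      then show "\<omega> \<in> (\<Union>r\<in>\<rat>. {\<omega>\<in>space M. c < dual r n \<omega>})" using \<omega> \<open>r \<in> \<rat>\<close> by auto
    next
      fix \<omega> assume "\<omega> \<in> (\<Union>r\<in>\<rat>. {\<omega>\<in>space M. c < dual r n \<omega>})"
      then show "\<omega> \<in> {\<omega>\<in>space M. c < p * tvar (empirical_cdf X n \<omega>) p}"
        using dual_le_tvar_empirical[of n _ \<omega>] False by (auto intro: less_le_trans)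
    qed
    also have "\<dots> \<in> sets M"
      by (intro sets.countable_UN' countable_rat image_subsetI) measurable
    finally show "{\<omega>\<in>space M. c < p * tvar (empirical_cdf X n \<omega>) p} \<in> sets M" .
  qed
  then have "(\<lambda>\<omega>. (p * tvar (empirical_cdf X n \<omega>) p) / p) \<in> borel_measurable M"
    by measurable
  then show ?thesis using p by simp
qed

text \<open>The loss from evaluating the empirical objective at the population quantile instead of
  at its maximiser, divided by \<open>p\<close>.\<close>

definition remainder :: "nat \<Rightarrow> 'a \<Rightarrow> real" where
  "remainder n \<omega> = tvar (empirical_cdf X n \<omega>) p - dual (\<mu>.Q p) n \<omega> / p"

lemma measurable_remainder[measurable]: "remainder n \<in> borel_measurable M"
  unfolding remainder_def[abs_def] using measurable_tvar_empirical[measurable] by measurable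

lemma remainder_nonneg: "n > 0 \<Longrightarrow> remainder n \<omega> \<ge> 0"
  using dual_le_tvar_empirical[of n "\<mu>.Q p" \<omega>] p by (simp add: remainder_def field_simps)

text \<open>
  \<open>p - avg z n \<omega>\<close> is a supergradient of \<open>\<lambda>x. dual x n \<omega>\<close> at \<open>\<mu>.Q p\<close>, and the hypotheses place the
  empirical quantile, where the dual attains its maximum, in \<open>{a..b}\<close>.
\<close>

lemma remainder_le:
  assumes "n > 0" and z: "\<And>t. 0 \<le> z t" "\<And>t. z t \<le> 1"
    "\<And>t. t < \<mu>.Q p \<Longrightarrow> z t = 1" "\<And>t. \<mu>.Q p < t \<Longrightarrow> z t = 0"
    and ab: "a \<le> \<mu>.Q p" "\<mu>.Q p \<le> b" "empirical_cdf X n \<omega> a < p" "p \<le> empirical_cdf X n \<omega> b"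
  shows "p * remainder n \<omega> \<le> (b - a) * \<bar>avg z n \<omega> - p\<bar>"
proof -
  let ?q = "\<mu>.Q p"
  obtain x where x: "p * tvar (empirical_cdf X n \<omega>) p = dual x n \<omega>"
    "\<And>y. x \<le> y \<longleftrightarrow> p \<le> empirical_cdf X n \<omega> y"
    using tvar_empirical_attained assms by blast
  have "\<not> x \<le> a" "x \<le> b" using ab x(2)[of a] x(2)[of b] by simp_all
  then have "a \<le> x" by simp
  \<comment> \<open>The value \<open>z t\<close> is a subgradient at \<open>?q\<close> of the convex
    map taking \<open>x\<close> to \<open>max (x - t) 0\<close>: the slope is 1 for
    \<open>t < ?q\<close>, 0 for \<open>t > ?q\<close>, and anything in \<open>{0..1}\<close> at the
    kink.\<close>
  have "max (?q - t) 0 + (x - ?q) * z t \<le> max (x - t) 0" for t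
  proof -
    have "max (?q - t) 0 + (x - ?q) * z t = (x - t) * z t"
      using z(3,4)[of t] by (cases t ?q rule: linorder_cases) (auto simp: algebra_simps)
    also have "\<dots> \<le> max (x - t) 0"
      using z(1,2)[of t] by (cases "t \<le> x") (auto simp: mult_left_le mult_nonpos_nonneg max_def)
    finally show ?thesis .
  qed
  then have "avg (\<lambda>t. max (?q - t) 0 + (x - ?q) * z t) n \<omega> \<le> avg (\<lambda>t. max (x - t) 0) n \<omega>"
    unfolding avg_def by (intro divide_right_mono sum_mono) auto
  moreover have "avg (\<lambda>t. max (?q - t) 0 + (x - ?q) * z t) n \<omega> = avg (\<lambda>t. max (?q - t) 0) n \<omega> + (x - ?q) * avg z n \<omega>"
    by (simp add: avg_def sum.distrib sum_distrib_left add_divide_distrib)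
  ultimately have "dual x n \<omega> - dual ?q n \<omega> \<le> (x - ?q) * (p - avg z n \<omega>)"
    by (simp add: algebra_simps)
  also have "\<dots> \<le> \<bar>x - ?q\<bar> * \<bar>p - avg z n \<omega>\<bar>"
    by (metis abs_ge_self abs_mult)
  also have "\<dots> \<le> (b - a) * \<bar>avg z n \<omega> - p\<bar>"
    using \<open>a \<le> x\<close> \<open>x \<le> b\<close> ab(1,2) by (intro mult_mono) auto
  finally have "dual x n \<omega> - dual ?q n \<omega> \<le> (b - a) * \<bar>avg z n \<omega> - p\<bar>" .
  moreover have "p * remainder n \<omega> = p * tvar (empirical_cdf X n \<omega>) p - dual ?q n \<omega>"
    unfolding remainder_def right_diff_distrib using p by simp
  ultimately show ?thesis
    using x(1) by linarith
qed

text \<open>Off the first two events the empirical quantile lies in \<open>{a..b}\<close>, so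
  \<open>remainder_le\<close> applies and Chebyshev's inequality for \<open>z\<close> gives the last
  term. The bracket stays free: any fixed one yields consistency, while a narrow one is needed at
  scale \<open>1 / sqrt n\<close>.\<close>

lemma prob_remainder_le:
  assumes "n > 0" "\<epsilon> > 0" and a: "\<mu>.C a < p" and b: "p < \<mu>.C b"
  shows "prob {\<omega>\<in>space M. \<bar>remainder n \<omega>\<bar> > \<epsilon>} \<le>
    prob {\<omega>\<in>space M. p - \<mu>.C a \<le> \<bar>avg (indicator {..a}) n \<omega> - \<mu>.C a\<bar>} +
    prob {\<omega>\<in>space M. \<mu>.C b - p \<le> \<bar>avg (indicator {..b}) n \<omega> - \<mu>.C b\<bar>} +
    (b - a)\<^sup>2 / (real n * (p * \<epsilon>)\<^sup>2)" (is "_ \<le> prob ?A + prob ?B + _")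
proof -
  obtain z where z[measurable]: "z \<in> borel_measurable borel" and z': "\<And>t. 0 \<le> z t" "\<And>t. z t \<le> 1"
    "\<And>t. t < \<mu>.Q p \<Longrightarrow> z t = 1" "\<And>t. \<mu>.Q p < t \<Longrightarrow> z t = 0" "\<mu>.expectation z = p"
    using \<mu>.exists_quantile_weight[OF p] by blast
  have ab: "a < \<mu>.Q p" "\<mu>.Q p \<le> b"
    using \<mu>.Q_le_iff[OF p, of a] \<mu>.Q_le_iff[OF p, of b] a b by auto
  then have "a < b" by simp
  \<comment> \<open>Chosen so that \<open>(b - a) * \<delta> = p * \<epsilon>\<close>.\<close>
  define \<delta> where "\<delta> = p * \<epsilon> / (b - a)"
  have "\<delta> > 0" using \<open>a < b\<close> p assms by (simp add: \<delta>_def)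
  let ?Z = "{\<omega>\<in>space M. \<delta> \<le> \<bar>avg z n \<omega> - \<mu>.expectation z\<bar>}"
  have z_sq: "(z t)\<^sup>2 \<le> 1" for t using z'(1,2)[of t] by (simp add: power_le_one)
  have z_int: "integrable \<mu> (\<lambda>t. (z t)\<^sup>2)"
    by (rule \<mu>.integrable_const_bound[where B=1]) (auto simp: z_sq)
  have "\<mu>.variance z \<le> 1"
  proof -
    have "\<mu>.variance z = \<mu>.expectation (\<lambda>t. (z t)\<^sup>2) - (\<mu>.expectation z)\<^sup>2"
      by (rule \<mu>.variance_eq[OF \<mu>.square_integrable_imp_integrable[OF _ z_int] z_int]) simp
    also have "\<dots> \<le> \<mu>.expectation (\<lambda>t. (z t)\<^sup>2)" by simp
    also have "\<dots> \<le> \<mu>.expectation (\<lambda>t. 1)" by (intro integral_mono z_int z_sq) auto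
    finally show ?thesis using \<mu>.prob_space by simp
  qed
  have Z: "prob ?Z \<le> (b - a)\<^sup>2 / (real n * (p * \<epsilon>)\<^sup>2)"
  proof -
    have "prob ?Z \<le> \<mu>.variance z / (real n * \<delta>\<^sup>2)"
      by (rule prob_avg_deviation_le[OF z z_int assms(1) \<open>\<delta> > 0\<close>])
    also have "\<dots> \<le> 1 / (real n * \<delta>\<^sup>2)"
      using \<open>\<mu>.variance z \<le> 1\<close> by (intro divide_right_mono) auto
    also have "\<dots> = (b - a)\<^sup>2 / (real n * (p * \<epsilon>)\<^sup>2)"
      by (simp add: \<delta>_def power_divide)
    finally show ?thesis .
  qed
  have "{\<omega>\<in>space M. \<bar>remainder n \<omega>\<bar> > \<epsilon>} \<subseteq> (?A \<union> ?B) \<union> ?Z"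
  proof (rule subsetI, rule ccontr)
    fix \<omega> assume "\<omega> \<in> {\<omega>\<in>space M. \<bar>remainder n \<omega>\<bar> > \<epsilon>}" and not: "\<omega> \<notin> (?A \<union> ?B) \<union> ?Z"
    then have \<omega>: "\<omega> \<in> space M" "\<epsilon> < \<bar>remainder n \<omega>\<bar>" "\<omega> \<notin> ?Z"
      by auto
    \<comment> \<open>Deviations smaller than the distance to \<open>p\<close> leave the empirical
      cdf on the same side of \<open>p\<close> as \<open>\<mu>.C\<close>.\<close>
    have "\<not> p - \<mu>.C a \<le> \<bar>avg (indicator {..a}) n \<omega> - \<mu>.C a\<bar>"
        "\<not> \<mu>.C b - p \<le> \<bar>avg (indicator {..b}) n \<omega> - \<mu>.C b\<bar>"
      using not \<omega>(1) by auto
    then have "empirical_cdf X n \<omega> a < p" "p \<le> empirical_cdf X n \<omega> b"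
      by (auto simp: empirical_cdf_eq_avg)
    then have "p * remainder n \<omega> \<le> (b - a) * \<bar>avg z n \<omega> - p\<bar>"
      using ab by (intro remainder_le[OF assms(1) z'(1-4)]) auto
    also have "\<dots> < (b - a) * \<delta>"
      using \<omega> \<open>a < b\<close> z'(5) by (intro mult_strict_left_mono) auto
    also have "\<dots> = p * \<epsilon>" using \<open>a < b\<close> by (simp add: \<delta>_def)
    finally show False
      using \<omega>(2) remainder_nonneg[OF assms(1), of \<omega>] p by simp
  qed
  then have "prob {\<omega>\<in>space M. \<bar>remainder n \<omega>\<bar> > \<epsilon>} \<le> prob ((?A \<union> ?B) \<union> ?Z)"
    by (intro finite_measure_mono) auto
  also have "\<dots> \<le> prob (?A \<union> ?B) + prob ?Z" by (intro measure_Un_le) auto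
  also have "prob (?A \<union> ?B) \<le> prob ?A + prob ?B" by (intro measure_Un_le) auto
  finally show ?thesis using Z by linarith
qed

lemma prob_cdf_deviation_tendsto:
  assumes "\<epsilon> > 0"
  shows "(\<lambda>n. prob {\<omega>\<in>space M. \<epsilon> \<le> \<bar>avg (indicator {..x}) n \<omega> - \<mu>.C x\<bar>}) \<longlonglongrightarrow> 0"
proof -
  have "integrable \<mu> (\<lambda>t. (indicator {..x} t :: real)\<^sup>2)"
    by (rule \<mu>.integrable_const_bound[where B=1]) (auto simp: indicator_def)
  then show ?thesis
    using weak_law_square_integrable[of "indicator {..x}" \<epsilon>] assms by (simp add: cdf_def)
qed

lemma remainder_converges_in_probability:
  "converges_in_probability M remainder 0"
  unfolding converges_in_probability_def
proof (intro conjI allI impI)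
  fix \<epsilon> :: real assume "\<epsilon> > 0"
  obtain a where a: "\<mu>.C a < p"
    using order_tendstoD(2)[OF \<mu>.cdf_lim_at_bot p(1)] by (auto simp: eventually_at_bot_linorder)
  obtain b where b: "p < \<mu>.C b"
    using order_tendstoD(1)[OF \<mu>.cdf_lim_at_top_prob p(2)] by (auto simp: eventually_at_top_linorder)
  let ?u = "\<lambda>n. prob {\<omega>\<in>space M. p - \<mu>.C a \<le> \<bar>avg (indicator {..a}) n \<omega> - \<mu>.C a\<bar>} +
    prob {\<omega>\<in>space M. \<mu>.C b - p \<le> \<bar>avg (indicator {..b}) n \<omega> - \<mu>.C b\<bar>} +
    (b - a)\<^sup>2 / (p * \<epsilon>)\<^sup>2 / real n"
  show "(\<lambda>n. prob {\<omega>\<in>space M. \<bar>remainder n \<omega> - 0\<bar> > \<epsilon>}) \<longlonglongrightarrow> 0"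
  proof (rule tendsto_sandwich[OF _ _ tendsto_const])
    have "?u \<longlonglongrightarrow> 0 + 0 + 0"
      using a b by (intro tendsto_add prob_cdf_deviation_tendsto lim_const_over_n) auto
    then show "?u \<longlonglongrightarrow> 0" by simp
    show "\<forall>\<^sub>F n in sequentially. prob {\<omega>\<in>space M. \<bar>remainder n \<omega> - 0\<bar> > \<epsilon>} \<le> ?u n"
      using eventually_gt_at_top[of 0]
    proof eventually_elim
      case (elim n)
      then show ?case using prob_remainder_le[OF elim \<open>\<epsilon> > 0\<close> a b] by (simp add: mult.commute)
    qed
  qed auto
qed measurable

text \<open>With \<open>\<epsilon> / sqrt n\<close> in place of \<open>\<epsilon>\<close> the
  Chebyshev term no longer decays in \<open>n\<close>; it equals
  \<open>(b - a)\<^sup>2 / (p * \<epsilon>)\<^sup>2\<close>. Continuity at \<open>p\<close> allows a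
  bracket narrow enough to make this small.\<close>

lemma scaled_remainder_converges_in_probability:
  assumes cont: "isCont (quantile \<mu>.C) p"
  shows "converges_in_probability M (\<lambda>n \<omega>. sqrt (real n) * remainder n \<omega>) 0"
  unfolding converges_in_probability_def
proof (intro conjI allI impI)
  fix \<epsilon> :: real assume "\<epsilon> > 0"
  show "(\<lambda>n. prob {\<omega>\<in>space M. \<bar>sqrt (real n) * remainder n \<omega> - 0\<bar> > \<epsilon>}) \<longlonglongrightarrow> 0"
  proof (rule LIMSEQ_I)
    fix r :: real assume "r > 0"
    \<comment> \<open>The half-width for which the Chebyshev term equals
      \<open>r / 2\<close>.\<close>
    define \<eta> where "\<eta> = p * \<epsilon> * sqrt (r / 2) / 2"
    have "\<eta> > 0" using p \<open>\<epsilon> > 0\<close> \<open>r > 0\<close> by (simp add: \<eta>_def)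
    define a b where "a = \<mu>.Q p - \<eta>" and "b = \<mu>.Q p + \<eta>"
    have a: "\<mu>.C a < p"
      using \<mu>.Q_le_iff[OF p, of a] \<open>\<eta> > 0\<close> by (simp add: a_def)
    have b: "p < \<mu>.C b"
      using \<mu>.less_cdf_if_isCont_quantile[OF p cont, of b] \<open>\<eta> > 0\<close> by (simp add: b_def)
    have width: "(b - a)\<^sup>2 / (p * \<epsilon>)\<^sup>2 = r / 2"
      using p \<open>\<epsilon> > 0\<close> \<open>r > 0\<close> by (simp add: a_def b_def \<eta>_def power_mult_distrib power_divide)
    let ?u = "\<lambda>n. prob {\<omega>\<in>space M. p - \<mu>.C a \<le> \<bar>avg (indicator {..a}) n \<omega> - \<mu>.C a\<bar>} +
      prob {\<omega>\<in>space M. \<mu>.C b - p \<le> \<bar>avg (indicator {..b}) n \<omega> - \<mu>.C b\<bar>}"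
    have "?u \<longlonglongrightarrow> 0 + 0"
      using a b by (intro tendsto_add prob_cdf_deviation_tendsto) auto
    then have "\<forall>\<^sub>F n in sequentially. ?u n < r / 2"
      using \<open>r > 0\<close> by (intro order_tendstoD) auto
    then have "\<forall>\<^sub>F n in sequentially. norm (prob {\<omega>\<in>space M. \<bar>sqrt (real n) * remainder n \<omega> - 0\<bar> > \<epsilon>} - 0) < r"
      using eventually_gt_at_top[of 0]
    proof eventually_elim
      case (elim n)
      then have "sqrt (real n) > 0" by simp
      have "{\<omega>\<in>space M. \<bar>sqrt (real n) * remainder n \<omega> - 0\<bar> > \<epsilon>} = {\<omega>\<in>space M. \<bar>remainder n \<omega>\<bar> > \<epsilon> / sqrt (real n)}"
        using \<open>sqrt (real n) > 0\<close> by (simp add: abs_mult pos_divide_less_eq mult.commute)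
      then have le: "prob {\<omega>\<in>space M. \<bar>sqrt (real n) * remainder n \<omega> - 0\<bar> > \<epsilon>}
          \<le> ?u n + (b - a)\<^sup>2 / (real n * (p * (\<epsilon> / sqrt (real n)))\<^sup>2)"
        using prob_remainder_le[OF elim(2) _ a b, of "\<epsilon> / sqrt (real n)"] \<open>sqrt (real n) > 0\<close> \<open>\<epsilon> > 0\<close>
        by (simp only: divide_pos_pos)
      have "(b - a)\<^sup>2 / (real n * (p * (\<epsilon> / sqrt (real n)))\<^sup>2) = r / 2"
        using elim(2) width by (simp add: power_mult_distrib power_divide)
      from le[unfolded this] have "prob {\<omega>\<in>space M. \<bar>sqrt (real n) * remainder n \<omega> - 0\<bar> > \<epsilon>} < r"
        using elim(1) by linarith
      then show ?case by simp
    qed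
    then show "\<exists>N. \<forall>n\<ge>N. norm (prob {\<omega>\<in>space M. \<bar>sqrt (real n) * remainder n \<omega> - 0\<bar> > \<epsilon>} - 0) < r"
      by (simp add: eventually_sequentially)
  qed
qed measurable

section \<open>Decomposition of the estimation error, consistency and asymptotic normality\<close>

lemma tvar_empirical_decomposition:
  assumes neg: "integrable \<mu> (\<lambda>t. max (- t) 0)" and "c = \<mu>.Q p"
  shows "tvar (empirical_cdf X n \<omega>) p - tvar \<mu>.C p =
    - (avg (\<lambda>t. max (c - t) 0) n \<omega> - \<mu>.expectation (\<lambda>t. max (c - t) 0)) / p + remainder n \<omega>"
proof -
  have "tvar \<mu>.C p = (p * c - \<mu>.expectation (\<lambda>t. max (c - t) 0)) / p"
    using \<mu>.tvar_eq[OF neg p] p assms(2) by (simp add: field_simps)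
  then show ?thesis
    using p assms(2) by (simp add: remainder_def diff_divide_distrib)
qed

theorem tvar_empirical_consistent:
  assumes neg: "integrable \<mu> (\<lambda>t. max (- t) 0)"
  shows "converges_in_probability M (\<lambda>n \<omega>. tvar (empirical_cdf X n \<omega>) p) (tvar \<mu>.C p)"
  unfolding converges_in_probability_def
proof (intro conjI allI impI measurable_tvar_empirical)
  fix \<epsilon> :: real assume "\<epsilon> > 0"
  define g where "g t = max (\<mu>.Q p - t) 0" for t
  have g[measurable]: "g \<in> borel_measurable borel" unfolding g_def[abs_def] by measurable
  have g_int: "integrable \<mu> g"
    unfolding g_def[abs_def] by (rule \<mu>.integrable_shortfall[OF neg])
  \<comment> \<open>The threshold carries a factor \<open>p\<close> because the average enters the
    decomposition divided by \<open>p\<close>.\<close>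
  let ?A = "\<lambda>n. {\<omega>\<in>space M. p * (\<epsilon> / 2) < \<bar>avg g n \<omega> - \<mu>.expectation g\<bar>}"
  let ?B = "\<lambda>n. {\<omega>\<in>space M. \<epsilon> / 2 < \<bar>remainder n \<omega> - 0\<bar>}"
  have dec: "tvar (empirical_cdf X n \<omega>) p - tvar \<mu>.C p = - (avg g n \<omega> - \<mu>.expectation g) / p + remainder n \<omega>" for n \<omega>
    unfolding g_def[abs_def] by (rule tvar_empirical_decomposition[OF neg refl])
  show "(\<lambda>n. prob {\<omega>\<in>space M. \<bar>tvar (empirical_cdf X n \<omega>) p - tvar \<mu>.C p\<bar> > \<epsilon>}) \<longlonglongrightarrow> 0"
  proof (rule tendsto_sandwich[OF _ _ tendsto_const])
    have "(\<lambda>n. prob (?A n)) \<longlonglongrightarrow> 0"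
      using p \<open>\<epsilon> > 0\<close> by (intro weak_law_nonneg[OF g g_int]) (auto simp: g_def)
    moreover have "\<forall>\<epsilon>>0. (\<lambda>n. prob {\<omega>\<in>space M. \<epsilon> < \<bar>remainder n \<omega> - 0\<bar>}) \<longlonglongrightarrow> 0"
      using remainder_converges_in_probability unfolding converges_in_probability_def by blast
    then have "(\<lambda>n. prob (?B n)) \<longlonglongrightarrow> 0"
      by (rule allE[of _ "\<epsilon> / 2"]) (use \<open>\<epsilon> > 0\<close> in simp)
    ultimately show "(\<lambda>n. prob (?A n) + prob (?B n)) \<longlonglongrightarrow> 0"
      by (rule tendsto_add_zero)
    have "prob {\<omega>\<in>space M. \<bar>tvar (empirical_cdf X n \<omega>) p - tvar \<mu>.C p\<bar> > \<epsilon>} \<le> prob (?A n) + prob (?B n)" for n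
    proof -
      have "\<omega> \<in> ?A n \<union> ?B n"
        if "\<omega> \<in> space M" "\<epsilon> < \<bar>tvar (empirical_cdf X n \<omega>) p - tvar \<mu>.C p\<bar>" for \<omega>
      proof (rule ccontr)
        assume "\<omega> \<notin> ?A n \<union> ?B n"
        then have "\<bar>avg g n \<omega> - \<mu>.expectation g\<bar> \<le> p * (\<epsilon> / 2)" "\<bar>remainder n \<omega>\<bar> \<le> \<epsilon> / 2"
          using that by auto
        moreover from this(1) have "\<bar>- (avg g n \<omega> - \<mu>.expectation g) / p\<bar> \<le> \<epsilon> / 2"
          using p by (simp add: abs_divide pos_divide_le_eq mult.commute abs_minus_commute)
        ultimately show False using that(2) unfolding dec by linarith
      qed
      then have "prob {\<omega>\<in>space M. \<bar>tvar (empirical_cdf X n \<omega>) p - tvar \<mu>.C p\<bar> > \<epsilon>} \<le> prob (?A n \<union> ?B n)"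
        by (intro finite_measure_mono) auto
      also have "\<dots> \<le> prob (?A n) + prob (?B n)" by (intro measure_Un_le) auto
      finally show ?thesis .
    qed
    then show "\<forall>\<^sub>F n in sequentially. prob {\<omega>\<in>space M. \<bar>tvar (empirical_cdf X n \<omega>) p - tvar \<mu>.C p\<bar> > \<epsilon>}
        \<le> prob (?A n) + prob (?B n)" by simp
  qed auto
qed

theorem tvar_empirical_asymptotically_normal:
  assumes sq: "integrable \<mu> (\<lambda>t. (max (- t) 0)\<^sup>2)" and cont: "isCont (quantile \<mu>.C) p"
  shows "converges_in_distribution M
    (\<lambda>n \<omega>. sqrt (real n) * (tvar (empirical_cdf X n \<omega>) p - tvar \<mu>.C p))
    (normal_distribution 0 (tvar_variance \<mu>.C p))"
proof -
  have neg: "integrable \<mu> (\<lambda>t. max (- t) 0)"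
    by (rule \<mu>.square_integrable_imp_integrable[OF _ sq]) simp
  define W where "W t = max (\<mu>.Q p - t) 0" for t
  \<comment> \<open>Absorbing the sign and the factor \<open>1 / p\<close> into \<open>g\<close>
    makes the error equal to a centred average plus \<open>remainder\<close>, with
    \<open>\<mu>.variance g\<close> already the claimed variance.\<close>
  define g where "g t = - W t / p" for t
  have W[measurable]: "W \<in> borel_measurable borel" unfolding W_def[abs_def] by measurable
  have g[measurable]: "g \<in> borel_measurable borel" unfolding g_def[abs_def] by measurable
  have W_sq: "integrable \<mu> (\<lambda>t. (W t)\<^sup>2)"
    unfolding W_def by (rule \<mu>.integrable_shortfall_square[OF sq])
  then have g_sq: "integrable \<mu> (\<lambda>t. (g t)\<^sup>2)"
    by (simp add: g_def power_divide)
  have g_mean: "\<mu>.expectation g = - \<mu>.expectation W / p"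
    by (simp add: g_def[abs_def])
  have "(g t - \<mu>.expectation g)\<^sup>2 = (W t - \<mu>.expectation W)\<^sup>2 / p\<^sup>2" for t
    using p unfolding g_mean by (simp add: g_def power2_eq_square field_simps)
  then have g_var: "\<mu>.variance g = tvar_variance \<mu>.C p"
    using \<mu>.tvar_variance_eq[OF p sq] by (simp add: W_def[abs_def])
  have "converges_in_distribution M
      (\<lambda>n \<omega>. sqrt (real n) * (avg g n \<omega> - \<mu>.expectation g) + sqrt (real n) * remainder n \<omega>)
      (normal_distribution 0 (\<mu>.variance g))"
    by (intro converges_in_distribution_add_vanishing char_scaled_avg_tendsto g g_sq
        scaled_remainder_converges_in_probability cont real_distribution_normal_distribution) auto
  moreover have "sqrt (real n) * (avg g n \<omega> - \<mu>.expectation g) + sqrt (real n) * remainder n \<omega>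
      = sqrt (real n) * (tvar (empirical_cdf X n \<omega>) p - tvar \<mu>.C p)" for n \<omega>
  proof -
    have "avg g n \<omega> = - avg W n \<omega> / p"
      by (simp add: avg_def g_def sum_negf sum_divide_distrib[symmetric] mult.commute)
    then have "tvar (empirical_cdf X n \<omega>) p - tvar \<mu>.C p = avg g n \<omega> - \<mu>.expectation g + remainder n \<omega>"
      using tvar_empirical_decomposition[OF neg refl, of n \<omega>] p
      unfolding g_mean W_def[abs_def] by (simp add: diff_divide_distrib)
    then show ?thesis by (simp add: distrib_left)
  qed
  ultimately show ?thesis by (simp add: g_var)
qed

end

end

theorem mainTheorem14:
  fixes M :: "'a measure"
    and X :: "nat \<Rightarrow> 'a \<Rightarrow> real"
    and F :: "real \<Rightarrow> real"
    and p :: real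
  assumes "prob_space M"
    and "prob_space.indep_vars M (\<lambda>_. borel) X UNIV"
    and "\<And>i. cdf (distr M borel (X i)) = F"
    and "0 < p" and "p < 1"
  shows "(F \<in> neg_moment_class 1 \<longrightarrow>
            converges_in_probability M (\<lambda>n \<omega>. tvar (empirical_cdf X n \<omega>) p) (tvar F p)) \<and>
         (F \<in> neg_moment_class 2 \<and> isCont (quantile F) p \<longrightarrow>
            converges_in_distribution M
              (\<lambda>n \<omega>. sqrt (real n) * (tvar (empirical_cdf X n \<omega>) p - tvar F p))
              (normal_distribution 0 (tvar_variance F p)))"
proof -
  interpret prob_space M by fact
  have rv: "random_variable borel (X i)" for i
    using assms(2) by (auto simp: indep_vars_def)
  define \<mu> where "\<mu> = distr M borel (X 0)"
  have cdf: "cdf \<mu> = F" by (simp add: \<mu>_def assms(3))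
  interpret iid_sequence M X \<mu>
  proof
    show "distr M borel (X i) = \<mu>" for i
      \<comment> \<open>Only the cdfs are assumed equal; a cdf determines its law.\<close>
      unfolding \<mu>_def by (rule cdf_unique) (simp_all add: rv assms(3))
  qed fact
  \<comment> \<open>Membership in the class provides some law with cdf \<open>F\<close>; uniqueness
    identifies it with \<open>\<mu>\<close>.\<close>
  have moment: "integrable \<mu> (\<lambda>x. (max (- x) 0) ^ k)" if "F \<in> neg_moment_class k" for k
    using that cdf_unique[OF real_distribution_\<mu>] unfolding neg_moment_class_def cdf[symmetric] by auto
  show ?thesis
    using tvar_empirical_consistent[OF assms(4,5)] tvar_empirical_asymptotically_normal[OF assms(4,5)]
      moment[of 1] moment[of 2] by (simp add: cdf)
qed

end
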